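(* Suppose that $X,Y \in \mathcal{M}_n(\mathbb{R})$, and let $\mathbf{x} = \mathrm{diag}(X)$ and $\mathbf{y} = \mathrm{diag}(Y)$. Then \[ \|\mathbf{x}\|\|\mathbf{y}\| - \langle \mathbf{x},\mathbf{y}\rangle \leq \|X\|_{\mathrm{F}}\|Y\|_{\mathrm{F}} - \langle X,Y\rangle_{\mathrm{F}}. \]
   Context: $\mathcal{M}_n(\mathbb{R})$ is the set of real $n\times n$ matrices. $\mathrm{diag}(X)\in\mathbb{R}^n$ is the vector of diagonal entries $(x_{1,1},\ldots,x_{n,n})$ of $X$. $\langle\cdot,\cdot\rangle$ and $\|\cdot\|$ are the usual dot product and Euclidean norm on $\mathbb{R}^n$. $\langle X,Y\rangle_{\mathrm{F}} = \mathrm{tr}(X^TY) = \sum_{i,j} x_{i,j}y_{i,j}$ is the Frobenius inner product and $\|X\|_{\mathrm{F}}=\sqrt{\langle X,X\rangle_{\mathrm{F}}}$ is the Frobenius norm. *)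

theory Defs
  imports "HOL-Analysis.Analysis"
begin

definition diag_vec :: "real ^ 'n ^ 'n \<Rightarrow> real ^ 'n" where
  "diag_vec X = (\<chi> i. X $ i $ i)"

definition frobenius_inner :: "real ^ 'n ^ 'n \<Rightarrow> real ^ 'n ^ 'n \<Rightarrow> real" where
  "frobenius_inner X Y = trace (transpose X ** Y)"

definition frobenius_norm :: "real ^ 'n ^ 'n \<Rightarrow> real" where
  "frobenius_norm X = sqrt (frobenius_inner X X)"

lemma frobenius_inner_eq_sum:
  "frobenius_inner X Y = (\<Sum>i\<in>UNIV. \<Sum>j\<in>UNIV. X $ i $ j * Y $ i $ j)"
  unfolding frobenius_inner_def trace_def matrix_matrix_mult_def transpose_def
  by (simp, rule sum.swap)

end

theory Submission
  imports Defs
begin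

text \<open>The Frobenius inner product is the orthogonal sum of the inner product of the diagonals and
  that of the off-diagonal parts, so a matrix may be treated as a vector in a product of two inner
  product spaces whose first component is the diagonal. There the inequality says that the
  Cauchy--Schwarz deficit \<open>norm p * norm q - p \<bullet> q\<close> does not increase when a component is dropped.
  To see this, bound the contribution of the dropped component to \<open>p \<bullet> q\<close> by the product of its
  norms, and then apply Cauchy--Schwarz in the plane to the pairs of component norms.\<close>

lemma cauchy_schwarz_deficit_fst_le:
  fixes p q :: "'a::real_inner \<times> 'b::real_inner"
  shows "norm (fst p) * norm (fst q) - fst p \<bullet> fst q \<le> norm p * norm q - p \<bullet> q"
proof -
  have "norm (fst p) * norm (fst q) + norm (snd p) * norm (snd q)
      = (norm (fst p), norm (snd p)) \<bullet> (norm (fst q), norm (snd q))"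
    by simp
  also have "\<dots> \<le> norm (norm (fst p), norm (snd p)) * norm (norm (fst q), norm (snd q))"
    by (rule norm_cauchy_schwarz)
  also have "\<dots> = norm p * norm q"
    by (simp add: norm_prod_def)
  finally have "norm (fst p) * norm (fst q) + norm (snd p) * norm (snd q) \<le> norm p * norm q" .
  moreover have "p \<bullet> q \<le> fst p \<bullet> fst q + norm (snd p) * norm (snd q)"
    using norm_cauchy_schwarz[of "snd p" "snd q"] by (simp add: inner_prod_def)
  ultimately show ?thesis by linarith
qed

definition offdiag :: "real ^ 'n ^ 'n \<Rightarrow> real ^ 'n ^ 'n" where
  "offdiag X = (\<chi> i j. if i = j then 0 else X $ i $ j)"

text \<open>This makes \<open>X \<mapsto> (diag_vec X, offdiag X)\<close> an isometric embedding for the Frobenius inner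
  product, since the products \<open>X $ i $ j * Y $ i $ j\<close> never mix the two parts.\<close>

lemma frobenius_inner_eq_inner_diag_offdiag:
  "frobenius_inner X Y = (diag_vec X, offdiag X) \<bullet> (diag_vec Y, offdiag Y)"
proof -
  have row: "(\<Sum>j\<in>UNIV. X $ i $ j * Y $ i $ j)
      = X $ i $ i * Y $ i $ i + (\<Sum>j\<in>UNIV. offdiag X $ i $ j * offdiag Y $ i $ j)" for i
    by (simp add: offdiag_def sum.remove[of UNIV i])
  show ?thesis
    unfolding frobenius_inner_eq_sum row
    by (simp add: inner_vec_def diag_vec_def sum.distrib)
qed

theorem theorem2p1:
  fixes X Y :: "real ^ 'n ^ 'n"
    and x y :: "real ^ 'n"
  assumes "x = diag_vec X"
    and "y = diag_vec Y"
  shows "norm x * norm y - x \<bullet> y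
    \<le> frobenius_norm X * frobenius_norm Y - frobenius_inner X Y"
  using cauchy_schwarz_deficit_fst_le[of "(x, offdiag X)" "(y, offdiag Y)"]
  unfolding assms frobenius_norm_def frobenius_inner_eq_inner_diag_offdiag norm_eq_sqrt_inner
  by simp

end
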